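(* Let $(X,d)$ be a metric space, $Y$ a real Hausdorff topological vector space, $K\subset Y$ a proper convex cone, and $F:X\times X\rightrightarrows K$ a set-valued map such that $0\in F(x,x)$ for all $x\in X$ and $F(x_1,x_2)+F(x_2,x_3)\subseteq F(x_1,x_3)+K$ for all $x_1,x_2,x_3\in X$. Let $\mathcal{A}\subseteq X\times 2^Y$ be nonempty with $A\neq\emptyset$ for every $(x,A)\in\mathcal{A}$. Assume that for every $\preceq_F$-decreasing sequence $((x_n,A_n))_{n\ge1}\subset\mathcal{A}$ the sequence $(x_n)$ is Cauchy and there exists $(x,A)\in\mathcal{A}$ with $(x,A)\preceq_F(x_n,A_n)$ for all $n\ge1$. Then: (i) for every $(x,A)\in\mathcal{A}$ there exists $(\overline{x},\overline{A})\in\mathcal{A}$ such that $(\overline{x},\overline{A})\preceq_F(x,A)$ and, for every $(x',A')\in\mathcal{A}$, $(x',A')\preceq_F(\overline{x},\overline{A})$ implies $x'=\overline{x}$; (ii) assume that $z^*\in K^+$ is such that $\inf z^*(F(x,x'))>0$ for all $x,x'\in X$ with $x\ne x'$ and $\inf z^*(A)>-\infty$ for every $A$ with $(x,A)\in\mathcal{A}$ for some $x\in X$; then for every $(x,A)\in\mathcal{A}$ there exists $(\overline{x},\overline{A})\in\mathcal{A}$, minimal in $\mathcal{A}$ with respect to $\preceq_{F,z^*}$, such that $(\overline{x},\overline{A})\preceq_{F,z^*}(x,A)$ and, for every $(x',A')\in\mathcal{A}$, $(x',A')\preceq_F(\overline{x},\overline{A})$ implies $x'=\overline{x}$.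
   Context: A proper convex cone $K$ satisfies $0\in K$, $K+K\subset K$, $tK\subset K$ for $t\ge0$, and $\{0\}\ne K\ne Y$. $K^+=\{y^*\in Y^*\mid y^*(y)\ge0\ \forall y\in K\}$, where $Y^*$ is the topological dual. Sums of sets are Minkowski sums with $\emptyset+A=A+\emptyset=\emptyset$; the values of $F$ are (possibly empty) subsets of $K$; $\inf\emptyset=+\infty$. The preorder $\preceq_F$ on $X\times2^Y$ is defined by $(x_1,A_1)\preceq_F(x_2,A_2)\iff A_2\subset A_1+F(x_1,x_2)+K$. For $z^*\in K^+$ the partial order $\preceq_{F,z^*}$ on $X\times 2^Y$ is defined by: $(x_1,A_1)\preceq_{F,z^*}(x_2,A_2)$ iff either $(x_1,A_1)=(x_2,A_2)$, or $(x_1,A_1)\preceq_F(x_2,A_2)$ and $\inf z^*(A_1)<\inf z^*(A_2)$. A sequence $(w_n)_{n\ge1}$ is decreasing for a relation $\preceq$ if $w_{n+1}\preceq w_n$ for all $n$; an element $w$ is minimal in $\mathcal{A}$ if $w'\in\mathcal{A}$, $w'\preceq w$ imply $w'=w$. *)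

theory Defs
  imports "HOL-Analysis.Analysis" "HOL-Library.Set_Algebras"
begin

class real_topological_vector = topological_ab_group_add + real_vector +
  assumes tendsto_scaleR_nhds:
    "\<And>(c::real) x. LIM p (nhds c \<times>\<^sub>F nhds x). fst p *\<^sub>R snd p :> nhds (c *\<^sub>R x)"

instance real_normed_vector \<subseteq> real_topological_vector
proof
  fix c :: real and x :: 'a
  have "((\<lambda>p. fst p *\<^sub>R snd p) \<longlongrightarrow> c *\<^sub>R x) (nhds c \<times>\<^sub>F nhds x)"
    by (intro tendsto_scaleR filterlim_fst filterlim_snd)
  then show "LIM p (nhds c \<times>\<^sub>F nhds x). fst p *\<^sub>R snd p :> nhds (c *\<^sub>R x)" .
qed

(* By convex_cone_iff, the library's convex_cone means: contains 0, closed under sums,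
   closed under scaling by reals t >= 0. *)
definition proper_convex_cone :: "'b::real_vector set \<Rightarrow> bool"
  where "proper_convex_cone K \<longleftrightarrow> convex_cone K \<and> K \<noteq> {0} \<and> K \<noteq> UNIV"

definition topological_dual :: "('b::real_topological_vector \<Rightarrow> real) set"
  where "topological_dual = {f. linear f \<and> continuous_on UNIV f}"

definition dual_cone :: "'b::real_topological_vector set \<Rightarrow> ('b \<Rightarrow> real) set"
  where "dual_cone K = {f \<in> topological_dual. \<forall>y\<in>K. f y \<ge> 0}"

(* Sums of sets are the Minkowski sums of HOL-Library.Set_Algebras, for which the sum
   with the empty set is empty. *)
fun preceq_F ::
    "'b::real_vector set \<Rightarrow> ('a \<Rightarrow> 'a \<Rightarrow> 'b set) \<Rightarrow> 'a \<times> 'b set \<Rightarrow> 'a \<times> 'b set \<Rightarrow> bool"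
  where "preceq_F K F (x1, A1) (x2, A2) \<longleftrightarrow> A2 \<subseteq> A1 + F x1 x2 + K"

(* Taken in the extended reals, so that the infimum over the empty set is +\<infinity>. *)
definition inf_image :: "('b \<Rightarrow> real) \<Rightarrow> 'b set \<Rightarrow> ereal"
  where "inf_image z A = (INF y\<in>A. ereal (z y))"

fun preceq_Fz ::
    "'b::real_vector set \<Rightarrow> ('a \<Rightarrow> 'a \<Rightarrow> 'b set) \<Rightarrow> ('b \<Rightarrow> real) \<Rightarrow>
      'a \<times> 'b set \<Rightarrow> 'a \<times> 'b set \<Rightarrow> bool"
  where "preceq_Fz K F z (x1, A1) (x2, A2) \<longleftrightarrow>
    (x1, A1) = (x2, A2) \<or>
    preceq_F K F (x1, A1) (x2, A2) \<and> inf_image z A1 < inf_image z A2"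

definition decreasing_wrt :: "('w \<Rightarrow> 'w \<Rightarrow> bool) \<Rightarrow> (nat \<Rightarrow> 'w) \<Rightarrow> bool"
  where "decreasing_wrt le w \<longleftrightarrow> (\<forall>n. le (w (Suc n)) (w n))"

definition minimal_in :: "('w \<Rightarrow> 'w \<Rightarrow> bool) \<Rightarrow> 'w set \<Rightarrow> 'w \<Rightarrow> bool"
  where "minimal_in le S w \<longleftrightarrow> w \<in> S \<and> (\<forall>w'\<in>S. le w' w \<longrightarrow> w' = w)"

end

theory Submission
  imports Defs
begin

text \<open>
  Both parts rest on one ordering principle for a preorder and a gauge \<open>g\<close>: along a decreasing
  sequence that at each step almost maximizes the (truncated) gauge among all smaller elements,
  consecutive gauges tend to 0, hence so does the gauge from any common lower bound. For (i) the
  gauge is the distance of the first components, so all elements below a lower bound of the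
  sequence share its first component. For (ii) the gauge is the drop of \<open>inf z\<close>, so \<open>inf z\<close> is constant below
  such a lower bound, which is therefore minimal for the strict order. If a given element is not
  minimal, applying this to something strictly below it gives a minimal element strictly below it.
\<close>

text \<open>If some value of \<open>h\<close> is positive, half the supremum lies strictly below the
  supremum and is therefore exceeded by a value of \<open>h\<close>. Otherwise nonnegativity makes
  \<open>h\<close> vanish on \<open>D\<close>, and any element serves.\<close>

lemma exists_almost_maximal:
  fixes h :: "'w \<Rightarrow> real"
  assumes "a \<in> D" and nonneg: "\<And>w. w \<in> D \<Longrightarrow> 0 \<le> h w"
    and bdd: "bdd_above (h ` D)"
  shows "\<exists>v\<in>D. \<forall>w\<in>D. h w \<le> 2 * h v"
proof (cases "\<exists>v\<in>D. 0 < h v")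
  case False
  with \<open>a \<in> D\<close> nonneg show ?thesis
    by (intro bexI[of _ a] ballI) (auto simp: not_less intro: order_trans)
next
  case True
  then obtain u where u: "u \<in> D" "0 < h u" by blast
  define s where "s = (SUP w\<in>D. h w)"
  have up: "h w \<le> s" if "w \<in> D" for w
    unfolding s_def using that bdd by (rule cSUP_upper)
  from u up[of u] have "s / 2 < s" by simp
  then obtain v where "v \<in> D" "s / 2 < h v"
    unfolding s_def using less_cSUP_iff[OF _ bdd] \<open>a \<in> D\<close> by blast
  with up have "\<forall>w\<in>D. h w \<le> 2 * h v" by force
  with \<open>v \<in> D\<close> show ?thesis by blast
qed

text \<open>Every \<open>c\<close> below \<open>b\<close> competes in each almost maximal choice, so
  its gauge is controlled by the consecutive gauges. By reflexivity \<open>b\<close> is one of these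
  \<open>c\<close>, which lets uniqueness of limits compare \<open>c\<close> with
  \<open>b\<close>.\<close>

lemma lower_bound_with_vanishing_gauge:
  fixes R :: "'w \<Rightarrow> 'w \<Rightarrow> bool" and g :: "'w \<Rightarrow> 'w \<Rightarrow> real"
  assumes "reflp R" "transp R" and "a \<in> S"
    and nonneg: "\<And>v w. v \<in> S \<Longrightarrow> w \<in> S \<Longrightarrow> R v w \<Longrightarrow> 0 \<le> g v w"
    and lower: "\<And>w. (\<And>n. w n \<in> S) \<Longrightarrow> decreasing_wrt R w \<Longrightarrow> \<exists>b\<in>S. \<forall>n. R b (w n)"
    and lim: "\<And>w. (\<And>n. w n \<in> S) \<Longrightarrow> decreasing_wrt R w \<Longrightarrow> (\<lambda>n. g (w (Suc n)) (w n)) \<longlonglongrightarrow> 0"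
  obtains w b where "b \<in> S" "R b a" "\<And>c. c \<in> S \<Longrightarrow> R c b \<Longrightarrow> (\<lambda>n. g c (w n)) \<longlonglongrightarrow> 0"
proof -
  \<comment> \<open>Truncating at 1 supplies the upper bound that the almost maximal choice
    requires, since \<open>g\<close> may be unbounded below \<open>w\<close>.\<close>
  have "\<exists>v\<in>{v\<in>S. R v w}. \<forall>c\<in>{v\<in>S. R v w}. min 1 (g c w) \<le> 2 * min 1 (g v w)" if "w \<in> S" for w
  proof (rule exists_almost_maximal)
    show "w \<in> {v\<in>S. R v w}" using that \<open>reflp R\<close> by (auto dest: reflpD)
    show "bdd_above ((\<lambda>c. min 1 (g c w)) ` {v\<in>S. R v w})"
      by (rule bdd_aboveI[of _ 1]) auto
  qed (use that nonneg in auto)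
  then obtain f where f: "\<And>w. w \<in> S \<Longrightarrow> f w \<in> S \<and> R (f w) w"
    and f_max: "\<And>w c. w \<in> S \<Longrightarrow> c \<in> S \<Longrightarrow> R c w \<Longrightarrow> min 1 (g c w) \<le> 2 * min 1 (g (f w) w)"
    by (metis (mono_tags, lifting) mem_Collect_eq)
  define w where "w n = (f ^^ n) a" for n
  have wS: "w n \<in> S" for n
    by (induction n) (auto simp: w_def f \<open>a \<in> S\<close>)
  have dec: "decreasing_wrt R w"
    using f wS by (auto simp: decreasing_wrt_def w_def)
  from lower[OF wS dec] obtain b where b: "b \<in> S" "\<And>n. R b (w n)" by blast
  have "R b a" using b(2)[of 0] by (simp add: w_def)
  moreover have "(\<lambda>n. g c (w n)) \<longlonglongrightarrow> 0" if "c \<in> S" "R c b" for c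
  proof -
    have below: "R c (w n)" for n using \<open>transp R\<close> that(2) b(2) by (rule transpD)
    have "(\<lambda>n. min 1 (g c (w n))) \<longlonglongrightarrow> 0"
    proof (rule tendsto_sandwich)
      show "\<forall>\<^sub>F n in sequentially. 0 \<le> min 1 (g c (w n))"
        using nonneg[OF that(1) wS below] by simp
      show "\<forall>\<^sub>F n in sequentially. min 1 (g c (w n)) \<le> 2 * g (w (Suc n)) (w n)"
      proof (rule always_eventually, rule allI)
        fix n
        have "min 1 (g c (w n)) \<le> 2 * min 1 (g (w (Suc n)) (w n))"
          using f_max[OF wS that(1) below, of n] by (simp add: w_def)
        then show "min 1 (g c (w n)) \<le> 2 * g (w (Suc n)) (w n)" by simp
      qed
      show "(\<lambda>n. 2 * g (w (Suc n)) (w n)) \<longlonglongrightarrow> 0"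
        using tendsto_mult_left[OF lim[OF wS dec], of 2] by simp
    qed simp
    \<comment> \<open>Once the truncated gauge is below 1 it equals the gauge itself, so the limit
      carries over.\<close>
    moreover from this have "\<forall>\<^sub>F n in sequentially. min 1 (g c (w n)) < 1"
      by (rule order_tendstoD) simp
    then have "\<forall>\<^sub>F n in sequentially. min 1 (g c (w n)) = g c (w n)"
      by eventually_elim auto
    ultimately show ?thesis by (rule Lim_transform_eventually)
  qed
  ultimately show thesis using b(1) that by blast
qed

lemma reflp_preceq_F:
  fixes K :: "'b::real_vector set" and F :: "'a \<Rightarrow> 'a \<Rightarrow> 'b set"
  assumes "convex_cone K" "\<And>x. 0 \<in> F x x"
  shows "reflp (preceq_F K F)"
proof (rule reflpI)
  fix w :: "'a \<times> 'b set"
  obtain x A where w: "w = (x, A)" by (cases w)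
  have "0 \<in> K" using assms(1) by (simp add: convex_cone_iff)
  then have "a + 0 + 0 \<in> A + F x x + K" if "a \<in> A" for a
    using that assms(2) by (intro set_plus_intro)
  then show "preceq_F K F w w" by (auto simp: w)
qed

text \<open>Regrouping the Minkowski sum brings the two values of \<open>F\<close> together for the
  triangle inclusion; the surplus copies of \<open>K\<close> are absorbed by
  \<open>K + K \<subseteq> K\<close>.\<close>

lemma transp_preceq_F:
  fixes K :: "'b::real_vector set" and F :: "'a \<Rightarrow> 'a \<Rightarrow> 'b set"
  assumes "convex_cone K" and F: "\<And>x1 x2 x3. F x1 x2 + F x2 x3 \<subseteq> F x1 x3 + K"
  shows "transp (preceq_F K F)"
proof (rule transpI)
  fix v w u :: "'a \<times> 'b set"
  obtain x1 A1 x2 A2 x3 A3 where eq: "v = (x1, A1)" "w = (x2, A2)" "u = (x3, A3)"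
    by (cases v, cases w, cases u)
  assume "preceq_F K F v w" "preceq_F K F w u"
  then have A2: "A2 \<subseteq> A1 + F x1 x2 + K" and A3: "A3 \<subseteq> A2 + F x2 x3 + K"
    by (auto simp: eq)
  have K: "K + K \<subseteq> K"
    using assms(1) by (auto simp: convex_cone_iff elim!: set_plus_elim)
  have "A3 \<subseteq> (A1 + F x1 x2 + K) + F x2 x3 + K"
    using A3 A2 by (meson order_trans set_plus_mono2 order_refl)
  also have "\<dots> = A1 + (F x1 x2 + F x2 x3) + (K + K)" by (simp add: ac_simps)
  also have "\<dots> \<subseteq> A1 + (F x1 x3 + K) + K"
    by (rule set_plus_mono2[OF set_plus_mono2[OF order_refl F] K])
  also have "\<dots> = A1 + F x1 x3 + (K + K)" by (simp add: ac_simps)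
  also have "\<dots> \<subseteq> A1 + F x1 x3 + K" using K by (intro set_plus_mono2) auto
  finally show "preceq_F K F v u" by (simp add: eq)
qed

text \<open>Turns the set relation into a scalar one: each point of \<open>A2\<close> is
  \<open>a + f + k\<close>, and \<open>z\<close> is additive with \<open>0 \<le> z k\<close>. The
  extended reals also accommodate empty sets and infima that are not finite.\<close>

lemma preceq_F_inf_image:
  assumes "linear z" "\<And>y. y \<in> K \<Longrightarrow> 0 \<le> z y" "preceq_F K F (x1, A1) (x2, A2)"
  shows "inf_image z A1 + inf_image z (F x1 x2) \<le> inf_image z A2"
  unfolding inf_image_def[of z A2]
proof (rule INF_greatest)
  fix y assume "y \<in> A2"
  with assms(3) have "y \<in> A1 + F x1 x2 + K" by auto
  then obtain a f k where y: "y = a + f + k" "a \<in> A1" "f \<in> F x1 x2" "k \<in> K"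
    by (auto elim!: set_plus_elim)
  have "inf_image z A1 + inf_image z (F x1 x2) \<le> ereal (z a) + ereal (z f)"
    unfolding inf_image_def by (intro add_mono INF_lower y)
  also have "\<dots> \<le> ereal (z y)"
    using assms(2)[OF y(4)] by (simp add: y(1) linear_add[OF assms(1)])
  finally show "inf_image z A1 + inf_image z (F x1 x2) \<le> ereal (z y)" .
qed

lemma inf_image_less_PInf: "A \<noteq> {} \<Longrightarrow> inf_image z A < \<infinity>"
  using less_ereal.simps(4) unfolding inf_image_def INF_less_iff by blast

theorem theorem5p1:
  fixes K :: "'b::{real_topological_vector, t2_space} set"
    and F :: "'a::metric_space \<Rightarrow> 'a \<Rightarrow> 'b set"
    and \<A> :: "('a \<times> 'b set) set"
  assumes "proper_convex_cone K"
    and "\<And>x1 x2. F x1 x2 \<subseteq> K"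
    and "\<And>x. 0 \<in> F x x"
    and "\<And>x1 x2 x3. F x1 x2 + F x2 x3 \<subseteq> F x1 x3 + K"
    and "\<A> \<noteq> {}"
    and "\<And>x A. (x, A) \<in> \<A> \<Longrightarrow> A \<noteq> {}"
    and "\<And>(x :: nat \<Rightarrow> 'a) (A :: nat \<Rightarrow> 'b set).
           (\<And>n. (x n, A n) \<in> \<A>) \<Longrightarrow> decreasing_wrt (preceq_F K F) (\<lambda>n. (x n, A n)) \<Longrightarrow>
           Cauchy x \<and> (\<exists>(x', A') \<in> \<A>. \<forall>n. preceq_F K F (x', A') (x n, A n))"
  shows "(\<forall>(x, A) \<in> \<A>. \<exists>(xb, Ab) \<in> \<A>.
            preceq_F K F (xb, Ab) (x, A) \<and>
            (\<forall>(x', A') \<in> \<A>. preceq_F K F (x', A') (xb, Ab) \<longrightarrow> x' = xb))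
       \<and> (\<forall>z \<in> dual_cone K.
            (\<forall>x x'. x \<noteq> x' \<longrightarrow> inf_image z (F x x') > 0) \<longrightarrow>
            (\<forall>(x, A) \<in> \<A>. inf_image z A > -\<infinity>) \<longrightarrow>
            (\<forall>(x, A) \<in> \<A>. \<exists>(xb, Ab) \<in> \<A>.
               minimal_in (preceq_Fz K F z) \<A> (xb, Ab) \<and>
               preceq_Fz K F z (xb, Ab) (x, A) \<and>
               (\<forall>(x', A') \<in> \<A>. preceq_F K F (x', A') (xb, Ab) \<longrightarrow> x' = xb)))"
proof (intro conjI ballI impI)
  let ?R = "preceq_F K F"
  have cone: "convex_cone K" using assms(1) by (simp add: proper_convex_cone_def)
  have refl: "reflp ?R" using cone assms(3) by (rule reflp_preceq_F)
  have trans: "transp ?R" using cone assms(4) by (rule transp_preceq_F)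
  have seq: "Cauchy (\<lambda>n. fst (w n)) \<and> (\<exists>b\<in>\<A>. \<forall>n. ?R b (w n))"
    if "\<And>n. w n \<in> \<A>" "decreasing_wrt ?R w" for w
    using assms(7)[of "\<lambda>n. fst (w n)" "\<lambda>n. snd (w n)"] that by auto
  {
    fix p assume "p \<in> \<A>"
    obtain w :: "nat \<Rightarrow> 'a \<times> 'b set" and b where b: "b \<in> \<A>" "?R b p"
      "\<And>c. c \<in> \<A> \<Longrightarrow> ?R c b \<Longrightarrow> (\<lambda>n. dist (fst c) (fst (w n))) \<longlonglongrightarrow> 0"
    proof (rule lower_bound_with_vanishing_gauge[OF refl trans \<open>p \<in> \<A>\<close>,
          where g = "\<lambda>v w. dist (fst v) (fst w)"])
      fix w assume w: "\<And>n. w n \<in> \<A>" "decreasing_wrt ?R w"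
      then show "\<exists>b\<in>\<A>. \<forall>n. ?R b (w n)" using seq by blast
      from seq[OF w] have C: "Cauchy (\<lambda>n. fst (w n))" by blast
      show "(\<lambda>n. dist (fst (w (Suc n))) (fst (w n))) \<longlonglongrightarrow> 0"
      proof (rule LIMSEQ_I)
        fix r :: real assume "0 < r"
        from metric_CauchyD[OF C this]
        show "\<exists>N. \<forall>n\<ge>N. norm (dist (fst (w (Suc n))) (fst (w n)) - 0) < r"
          by (metis diff_zero dist_norm le_Suc_eq real_norm_def abs_of_nonneg zero_le_dist)
      qed
    next
      fix w :: "nat \<Rightarrow> 'a \<times> 'b set" and b
      assume "b \<in> \<A>" "?R b p"
        "\<And>c. c \<in> \<A> \<Longrightarrow> ?R c b \<Longrightarrow> (\<lambda>n. dist (fst c) (fst (w n))) \<longlonglongrightarrow> 0"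
      then show thesis by (rule that)
    qed simp
    have "fst c = fst b" if "c \<in> \<A>" "?R c b" for c
    proof -
      \<comment> \<open>Used for \<open>d = c\<close> and for \<open>d = b\<close>: both first
        components are limits of the same sequence.\<close>
      have "(\<lambda>n. fst (w n)) \<longlonglongrightarrow> fst d" if "d \<in> \<A>" "?R d b" for d
        using b(3)[OF that] by (subst tendsto_dist_iff) (simp add: dist_commute)
      then show ?thesis using that b(1) refl by (blast intro: LIMSEQ_unique dest: reflpD)
    qed
    with b show "case p of (x, A) \<Rightarrow> \<exists>(xb, Ab) \<in> \<A>. ?R (xb, Ab) (x, A) \<and>
            (\<forall>(x', A') \<in> \<A>. ?R (x', A') (xb, Ab) \<longrightarrow> x' = xb)"
      unfolding case_prod_beta prod.collapse by blast
  }
  fix z p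
  assume z: "z \<in> dual_cone K"
    and pos: "\<forall>x x'. x \<noteq> x' \<longrightarrow> inf_image z (F x x') > 0"
    and fin: "\<forall>(x, A) \<in> \<A>. inf_image z A > -\<infinity>" and "p \<in> \<A>"
  let ?i = "\<lambda>w. inf_image z (snd w)"
  \<comment> \<open>\<open>real_of_ereal\<close> sends infinite values to 0, so \<phi> represents
    the infimum only on \<A>, where nonemptiness and the lower bound on \<open>z\<close> rule
    infinite values out.\<close>
  define \<phi> where "\<phi> w = real_of_ereal (?i w)" for w :: "'a \<times> 'b set"
  have lin: "linear z" and zK: "\<And>y. y \<in> K \<Longrightarrow> 0 \<le> z y"
    using z by (auto simp: dual_cone_def topological_dual_def)
  have \<phi>: "?i w = ereal (\<phi> w)" if "w \<in> \<A>" for w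
  proof -
    obtain x A where "w = (x, A)" by (cases w)
    then have "- \<infinity> < ?i w" "?i w < \<infinity>"
      using that fin inf_image_less_PInf[OF assms(6)[of x A]] by auto
    then show ?thesis unfolding \<phi>_def by (cases "?i w") auto
  qed
  have drop: "ereal (\<phi> v) + inf_image z (F (fst v) (fst w)) \<le> ereal (\<phi> w)"
    if "v \<in> \<A>" "w \<in> \<A>" "?R v w" for v w
    using preceq_F_inf_image[OF lin zK, where F = F and ?x1.0 = "fst v" and ?A1.0 = "snd v" and ?x2.0 = "fst w"
      and ?A2.0 = "snd w"] that \<phi> by simp
  have mono: "\<phi> v \<le> \<phi> w" if "v \<in> \<A>" "w \<in> \<A>" "?R v w" for v w
  proof -
    have "0 \<le> inf_image z (F (fst v) (fst w))"
      unfolding inf_image_def using assms(2) zK by (intro INF_greatest) auto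
    then have "ereal (\<phi> v) + 0 \<le> ereal (\<phi> v) + inf_image z (F (fst v) (fst w))"
      by (rule add_left_mono)
    from order_trans[OF this drop[OF that]] show ?thesis by simp
  qed
  have strict: "\<phi> v < \<phi> w" if "v \<in> \<A>" "w \<in> \<A>" "?R v w" "fst v \<noteq> fst w" for v w
  proof -
    from pos that(4) have "0 < inf_image z (F (fst v) (fst w))" by blast
    \<comment> \<open>An infimum equal to \<infinity> is impossible here: by \<open>drop\<close>, it
      would put \<infinity> below the real number \<open>\<phi> w\<close>.\<close>
    then show ?thesis
      using drop[OF that(1-3)] by (cases "inf_image z (F (fst v) (fst w))") auto
  qed
  have Fz: "preceq_Fz K F z v w \<longleftrightarrow> v = w \<or> ?R v w \<and> \<phi> v < \<phi> w"
    if "v \<in> \<A>" "w \<in> \<A>" for v w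
    using \<phi>[OF that(1)] \<phi>[OF that(2)] by (cases v; cases w) auto
  have const: "\<exists>b\<in>\<A>. ?R b q \<and> (\<forall>c\<in>\<A>. ?R c b \<longrightarrow> \<phi> c = \<phi> b)" if q: "q \<in> \<A>" for q
  proof -
    obtain w b where b: "b \<in> \<A>" "?R b q"
      "\<And>c. c \<in> \<A> \<Longrightarrow> ?R c b \<Longrightarrow> (\<lambda>n. \<phi> (w n) - \<phi> c) \<longlonglongrightarrow> 0"
    proof (rule lower_bound_with_vanishing_gauge[OF refl trans q, where g = "\<lambda>v w. \<phi> w - \<phi> v"])
      fix w assume w: "\<And>n. w n \<in> \<A>" "decreasing_wrt ?R w"
      then obtain b where b: "b \<in> \<A>" "\<forall>n. ?R b (w n)" using seq by blast
      then show "\<exists>b\<in>\<A>. \<forall>n. ?R b (w n)" by blast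
      have dec: "decseq (\<lambda>n. \<phi> (w n))"
        using w mono by (auto simp: decseq_Suc_iff decreasing_wrt_def)
      \<comment> \<open>The common lower bound in the preorder bounds \<phi> from below along the
        sequence, so monotone convergence applies and consecutive drops vanish.\<close>
      have "\<forall>n. \<phi> b \<le> \<phi> (w n)"
        using mono[OF b(1) w(1)] b(2) by blast
      from decseq_convergent[OF dec this]
      obtain l where l: "(\<lambda>n. \<phi> (w n)) \<longlonglongrightarrow> l" by blast
      from tendsto_diff[OF l LIMSEQ_Suc[OF l]]
      show "(\<lambda>n. \<phi> (w n) - \<phi> (w (Suc n))) \<longlonglongrightarrow> 0" by simp
    next
      fix w b
      assume "b \<in> \<A>" "?R b q"
        "\<And>c. c \<in> \<A> \<Longrightarrow> ?R c b \<Longrightarrow> (\<lambda>n. \<phi> (w n) - \<phi> c) \<longlonglongrightarrow> 0"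
      then show thesis by (rule that)
    qed (simp add: mono)
    have "(\<lambda>n. \<phi> (w n)) \<longlonglongrightarrow> \<phi> d" if "d \<in> \<A>" "?R d b" for d
      using b(3)[OF that] by (simp add: LIM_zero_iff)
    then show ?thesis using b(1,2) refl by (blast intro: LIMSEQ_unique dest: reflpD)
  qed
  have "\<exists>b\<in>\<A>. minimal_in (preceq_Fz K F z) \<A> b \<and> preceq_Fz K F z b p"
  \<comment> \<open>Applying \<open>const\<close> to \<open>p\<close> directly could yield
    \<open>b \<noteq> p\<close> with \<open>\<phi> b = \<phi> p\<close>, which is not below
    \<open>p\<close> for \<open>preceq_Fz\<close>. Starting from a \<open>q\<close> with
    \<open>\<phi> q < \<phi> p\<close> secures the strict inequality.\<close>
  proof (cases "minimal_in (preceq_Fz K F z) \<A> p")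
    case True
    then show ?thesis using Fz \<open>p \<in> \<A>\<close> by blast
  next
    case False
    then obtain q where q: "q \<in> \<A>" "?R q p" "\<phi> q < \<phi> p"
      using \<open>p \<in> \<A>\<close> Fz by (auto simp: minimal_in_def)
    obtain b where b: "b \<in> \<A>" "?R b q" "\<And>c. c \<in> \<A> \<Longrightarrow> ?R c b \<Longrightarrow> \<phi> c = \<phi> b"
      using const[OF q(1)] by blast
    have "minimal_in (preceq_Fz K F z) \<A> b"
      unfolding minimal_in_def using b(1,3) Fz by (metis less_irrefl)
    moreover have "?R b p" using trans b(2) q(2) by (rule transpD)
    moreover have "\<phi> b < \<phi> p" using mono[OF b(1) q(1) b(2)] q(3) by simp
    ultimately show ?thesis using b(1) Fz \<open>p \<in> \<A>\<close> by blast
  qed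
  then obtain b where b: "b \<in> \<A>" "minimal_in (preceq_Fz K F z) \<A> b" "preceq_Fz K F z b p"
    by blast
  \<comment> \<open>A different first component would force \<open>\<phi> c < \<phi> b\<close> by
    \<open>strict\<close>, hence \<open>preceq_Fz K F z c b\<close>; minimality would then give
    \<open>c = b\<close>, a contradiction.\<close>
  have "fst c = fst b" if "c \<in> \<A>" "?R c b" for c
    using strict[OF that(1) b(1) that(2)] b(2) Fz[OF that(1) b(1)] that
    unfolding minimal_in_def by blast
  with b show "case p of (x, A) \<Rightarrow> \<exists>(xb, Ab) \<in> \<A>. minimal_in (preceq_Fz K F z) \<A> (xb, Ab) \<and>
      preceq_Fz K F z (xb, Ab) (x, A) \<and>
      (\<forall>(x', A') \<in> \<A>. ?R (x', A') (xb, Ab) \<longrightarrow> x' = xb)"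
    unfolding case_prod_beta prod.collapse by blast
qed

end
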